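(* Let $\mathbb{F}_q$ be a finite field, let $f\in\mathbb{F}_q[x]$ be a nonzero monic polynomial, and let $D=\{f_1,f_2,\ldots,f_k\}$ ($k\ge 1$) be a set of monic divisors of $f$ with $f\notin D$. Suppose that one of the following conditions holds: (1) $\mathbb{F}_q\ne\mathbb{F}_2$; (2) $\mathbb{F}_q=\mathbb{F}_2$ and $x(x+1)\nmid f$. Then the gcd-graph $G_f(D)$ is connected if and only if $\gcd(f_1,f_2,\ldots,f_k)=1$.
   Context: All polynomials are monic unless stated otherwise and gcd's are taken monic (so $\gcd(0,f)=f$). For a nonzero monic $f\in\mathbb{F}_q[x]$ and a set $D$ of monic divisors of $f$ with $f\notin D$, the gcd-graph $G_f(D)$ is the undirected loopless graph with vertex set the ring $\mathbb{F}_q[x]/(f)$ in which two vertices $u,v$ are adjacent if and only if $\gcd(u-v,f)\in D$. *)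

theory Defs
  imports
    "HOL-Library.Cardinality"
    "HOL-Computational_Algebra.Polynomial_Factorial"
    "Graph_Theory.Digraph_Component"
begin

text \<open>
  The base field has sort \<open>{finite, field_gcd}\<close>.  Compared with \<open>field\<close>, the class
  \<open>field_gcd\<close> does not restrict the field: its normalisation and gcd operations are
  determined by the field structure.  It is the class for which the library provides gcds of
  polynomials over a field, and these gcds are monic (or zero).
\<close>

lemma lead_coeff_gcd_eq_1:
  fixes p q :: "'a::field_gcd poly"
  assumes "p \<noteq> 0 \<or> q \<noteq> 0"
  shows "lead_coeff (gcd p q) = 1"
proof -
  have nz: "gcd p q \<noteq> 0"
    using assms by auto
  hence "unit_factor (gcd p q) = 1"
    using assms by (simp add: unit_factor_gcd)
  moreover have "unit_factor (lead_coeff (gcd p q)) = lead_coeff (gcd p q)"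
    using nz by (intro is_unit_unit_factor) (simp add: dvd_field_iff)
  ultimately show ?thesis
    by (simp add: unit_factor_poly_def one_pCons)
qed

lemma gcd_0_left_monic:
  fixes f :: "'a::field_gcd poly"
  assumes "lead_coeff f = 1"
  shows "gcd 0 f = f"
  using assms by (simp add: normalize_poly_eq_map_poly)

definition poly_cong :: "'a::field poly \<Rightarrow> 'a poly rel" where
  "poly_cong f = {(u, v). f dvd u - v}"

text \<open>The elements of \<open>F[x]/(f)\<close> are the residue classes \<open>u + (f)\<close>.\<close>

definition residue_classes :: "'a::field poly \<Rightarrow> 'a poly set set" where
  "residue_classes f = UNIV // poly_cong f"

text \<open>
  An undirected graph is a symmetric digraph, as usual in \<open>Graph_Theory\<close>.  Whether two residue
  classes are adjacent does not depend on the representatives; see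
  \<open>gcd_graph_adjacent_iff\<close> below.
\<close>

definition gcd_graph ::
    "'a::field_gcd poly \<Rightarrow> 'a poly set \<Rightarrow> 'a poly set pair_pre_digraph" where
  "gcd_graph f D =
     \<lparr> pverts = residue_classes f,
       parcs = {(U, V). U \<in> residue_classes f \<and> V \<in> residue_classes f \<and>
                        (\<exists>u\<in>U. \<exists>v\<in>V. gcd (u - v) f \<in> D)} \<rparr>"

lemma equiv_poly_cong: "equiv UNIV (poly_cong f)"
proof (rule equivI)
  show "sym (poly_cong f)"
    unfolding poly_cong_def by (auto intro!: symI simp: dvd_diff_commute)
  show "trans (poly_cong f)"
    unfolding poly_cong_def
  proof (rule transI, clarsimp)
    fix x y z assume "f dvd x - y" "f dvd y - z"
    hence "f dvd (x - y) + (y - z)" by (rule dvd_add)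
    thus "f dvd x - z" by simp
  qed
qed (auto simp: refl_on_def poly_cong_def)

lemma gcd_cong_mod:
  fixes f :: "'a::field_gcd poly"
  assumes "f dvd u - v"
  shows "gcd u f = gcd v f"
proof -
  obtain k where "u - v = f * k"
    using assms by (elim dvdE)
  hence "u = k * f + v"
    by (simp add: algebra_simps)
  thus ?thesis
    using gcd_add_mult[of f k v] by (simp add: gcd.commute)
qed

lemma gcd_graph_adjacent_iff:
  fixes f :: "'a::field_gcd poly"
  shows "(poly_cong f `` {u}, poly_cong f `` {v}) \<in> parcs (gcd_graph f D) \<longleftrightarrow> gcd (u - v) f \<in> D"
proof -
  have *: "gcd (u' - v') f = gcd (u - v) f"
    if "u' \<in> poly_cong f `` {u}" "v' \<in> poly_cong f `` {v}" for u' v'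
  proof -
    have "f dvd u - u'" "f dvd v - v'"
      using that by (simp_all add: poly_cong_def)
    hence "f dvd (u - u') - (v - v')"
      by (rule dvd_diff)
    hence "f dvd (u - v) - (u' - v')"
      by (simp add: algebra_simps)
    thus ?thesis
      by (rule gcd_cong_mod[symmetric])
  qed
  have self: "u \<in> poly_cong f `` {u}" "v \<in> poly_cong f `` {v}"
    by (simp_all add: poly_cong_def)
  have "(\<exists>u'\<in>poly_cong f `` {u}. \<exists>v'\<in>poly_cong f `` {v}. gcd (u' - v') f \<in> D) \<longleftrightarrow>
      gcd (u - v) f \<in> D"
  proof
    assume "\<exists>u'\<in>poly_cong f `` {u}. \<exists>v'\<in>poly_cong f `` {v}. gcd (u' - v') f \<in> D"
    then obtain u' v' where "u' \<in> poly_cong f `` {u}" "v' \<in> poly_cong f `` {v}"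
        and "gcd (u' - v') f \<in> D"
      by blast
    thus "gcd (u - v) f \<in> D"
      using * by metis
  next
    assume "gcd (u - v) f \<in> D"
    thus "\<exists>u'\<in>poly_cong f `` {u}. \<exists>v'\<in>poly_cong f `` {v}. gcd (u' - v') f \<in> D"
      using self by (intro bexI)
  qed
  thus ?thesis
    by (simp add: gcd_graph_def residue_classes_def quotientI)
qed

lemma residue_classes_cases:
  assumes "U \<in> residue_classes f"
  obtains u where "U = poly_cong f `` {u}"
  using assms unfolding residue_classes_def by (elim quotientE)

lemma finite_residue_classes:
  fixes f :: "'a::{finite,field} poly"
  assumes "f \<noteq> 0"
  shows "finite (residue_classes f)"
proof -
  let ?S = "{p :: 'a poly. degree p \<le> degree f}"
  have "?S \<subseteq> Poly ` {xs. set xs \<subseteq> UNIV \<and> length xs \<le> Suc (degree f)}"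
  proof
    fix p :: "'a poly" assume "p \<in> ?S"
    hence "length (coeffs p) \<le> Suc (degree f)"
      by (cases "p = 0") (auto simp: length_coeffs_degree)
    thus "p \<in> Poly ` {xs. set xs \<subseteq> UNIV \<and> length xs \<le> Suc (degree f)}"
      by (intro image_eqI[of _ _ "coeffs p"]) auto
  qed
  moreover have "finite {xs :: 'a list. set xs \<subseteq> UNIV \<and> length xs \<le> Suc (degree f)}"
    by (rule finite_lists_length_le) simp
  ultimately have fin: "finite ?S"
    using finite_surj by blast
  have "residue_classes f \<subseteq> (\<lambda>u. poly_cong f `` {u}) ` ?S"
  proof
    fix U assume "U \<in> residue_classes f"
    then obtain u where U: "U = poly_cong f `` {u}"
      by (rule residue_classes_cases)
    have "(u, u mod f) \<in> poly_cong f"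
      by (simp add: poly_cong_def minus_mod_eq_mult_div)
    hence "U = poly_cong f `` {u mod f}"
      unfolding U by (rule equiv_class_eq[OF equiv_poly_cong])
    moreover have "u mod f \<in> ?S"
      using degree_mod_less[OF assms, of u] by auto
    ultimately show "U \<in> (\<lambda>u. poly_cong f `` {u}) ` ?S"
      by blast
  qed
  thus ?thesis
    using fin finite_surj by blast
qed

lemma pair_graph_gcd_graph:
  fixes f :: "'a::{finite,field_gcd} poly"
  assumes "lead_coeff f = 1" and "f \<notin> D"
  shows "pair_graph (gcd_graph f D)"
proof -
  have nz: "f \<noteq> 0"
    using assms(1) by auto
  have verts: "pverts (gcd_graph f D) = residue_classes f"
    by (simp add: gcd_graph_def)
  have arcs: "parcs (gcd_graph f D) \<subseteq> residue_classes f \<times> residue_classes f"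
    by (auto simp: gcd_graph_def)
  have fin: "finite (parcs (gcd_graph f D))"
    using arcs finite_residue_classes[OF nz] finite_subset by blast
  have sym: "(V, U) \<in> parcs (gcd_graph f D)" if arc: "(U, V) \<in> parcs (gcd_graph f D)" for U V
  proof -
    obtain u v where UV: "U = poly_cong f `` {u}" "V = poly_cong f `` {v}"
      using arc arcs by (blast elim: residue_classes_cases)
    have "gcd (v - u) f = gcd (u - v) f"
      using gcd_neg1[of "u - v" f] by simp
    thus ?thesis
      using arc unfolding UV gcd_graph_adjacent_iff by simp
  qed
  have loop: "(U, U) \<notin> parcs (gcd_graph f D)" for U
  proof
    assume *: "(U, U) \<in> parcs (gcd_graph f D)"
    then obtain u where "U = poly_cong f `` {u}"
      using arcs by (blast elim: residue_classes_cases)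
    with * have "gcd (u - u) f \<in> D"
      by (simp only: gcd_graph_adjacent_iff)
    thus False
      using assms gcd_0_left_monic[OF assms(1)] by simp
  qed
  show ?thesis
  proof
    fix e assume "e \<in> parcs (gcd_graph f D)"
    thus "fst e \<in> pverts (gcd_graph f D)" "snd e \<in> pverts (gcd_graph f D)"
      "fst e \<noteq> snd e"
      using arcs loop[of "fst e"] by (auto simp: verts)
  next
    show "finite (pverts (gcd_graph f D))"
      using finite_residue_classes[OF nz] by (simp add: verts)
    show "symmetric (with_proj (gcd_graph f D))"
      using sym by (auto simp: symmetric_def intro: symI)
  qed (rule fin)
qed

end

theory Submission
  imports Defs
begin

text \<open>
  Adjacency in the gcd-graph depends only on the difference of two vertices, so the polynomials
  \<open>a\<close> for which every class \<open>u + (f)\<close> is joined by a walk to \<open>u + a + (f)\<close> form an additively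
  closed set \<open>A\<close>, and the graph is connected precisely when \<open>A\<close> is everything.

  If \<open>w\<close> divides every element of \<open>D\<close>, then walks preserve residues modulo \<open>w\<close>; connecting
  \<open>0\<close> to \<open>1\<close> forces \<open>w\<close> to be a unit.

  For the converse, fix \<open>d \<in> D\<close> and write \<open>f = d * g\<close>. Then \<open>gcd (d * u) f = d\<close> for every \<open>u\<close>
  coprime to \<open>g\<close>, so \<open>A\<close> contains all these multiples \<open>d * u\<close>. The key point is that the
  polynomials coprime to \<open>g\<close> generate all polynomials additively
  (\<open>coprime_polys_generate_additively\<close>), whence \<open>A\<close> contains every multiple of \<open>d\<close>. Therefore
  \<open>A\<close> contains the ideal generated by \<open>D\<close>, which contains \<open>Gcd D = 1\<close> by Bezout.

  The hypothesis on the field enters only in the key point. The ring \<open>F[x]/(g)\<close> fails to be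
  additively generated by its units only if it maps onto \<open>F\<^sub>2 \<times> F\<^sub>2\<close>, where the units generate just
  the diagonal; this happens only when \<open>F = F\<^sub>2\<close> and both \<open>x\<close> and \<open>x + 1\<close> divide \<open>g\<close>,
  hence \<open>f\<close>.
\<close>

section \<open>Additive generation by polynomials coprime to a modulus\<close>

text \<open>
  The Chinese remainder theorem would give summands that are nonzero modulo each prime divisor of
  \<open>g\<close>; the product \<open>h\<close> of the prime divisors of \<open>g\<close> that do not divide \<open>p\<close> makes them
  explicit, as \<open>p = (c * p + h) + ((1 - c) * p - h)\<close>. Modulo a prime dividing \<open>p\<close> only \<open>\<plusminus>h\<close>
  remains, which is nonzero; modulo any other prime divisor of \<open>g\<close> the term \<open>h\<close> vanishes and the
  assumption on \<open>c\<close> takes over.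
\<close>

lemma sum_of_two_coprime:
  fixes g c p :: "'b :: factorial_ring_gcd"
  assumes "g \<noteq> 0"
    and c: "\<And>P. prime P \<Longrightarrow> P dvd g \<Longrightarrow> \<not> P dvd p \<Longrightarrow> \<not> P dvd c \<and> \<not> P dvd 1 - c"
  obtains u v where "coprime u g" "coprime v g" "p = u + v"
proof -
  define S where "S = {P. prime P \<and> P dvd g \<and> \<not> P dvd p}"
  define h where "h = \<Prod>S"
  have fin: "finite S"
    by (rule finite_subset[OF _ finite_prime_divisors[OF assms(1)]]) (auto simp: S_def)
  have h: "P dvd h \<longleftrightarrow> \<not> P dvd p" if P: "prime P" "P dvd g" for P
  proof
    assume "P dvd h"
    then obtain Q where Q: "Q \<in> S" "P dvd Q"
      using P fin by (auto simp: h_def prime_dvd_prod_iff)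
    hence "P = Q"
      using P by (intro primes_dvd_imp_eq) (auto simp: S_def)
    thus "\<not> P dvd p"
      using Q by (simp add: S_def)
  next
    assume "\<not> P dvd p"
    thus "P dvd h"
      using P fin by (auto simp: h_def S_def intro: dvd_prodI)
  qed
  have coprimeI: "coprime u g" if "\<And>P. prime P \<Longrightarrow> P dvd g \<Longrightarrow> \<not> P dvd u" for u
  proof -
    have "is_unit (gcd u g)"
      using that assms(1) by (intro no_prime_divisors_imp_unit) (auto simp: prime_def)
    thus ?thesis
      by (simp only: is_unit_gcd)
  qed
  have nd: "\<not> P dvd e * p + s * h"
    if P: "prime P" "P dvd g" and e: "\<not> P dvd p \<Longrightarrow> \<not> P dvd e" and s: "is_unit s" for P e s
  proof (cases "P dvd p")
    case True
    thus ?thesis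
      using h[OF P] s by (simp add: dvd_add_right_iff dvd_mult_unit_iff')
  next
    case False
    hence "P dvd s * h" "\<not> P dvd e * p"
      using h[OF P] e P by (simp_all add: prime_dvd_mult_iff)
    thus ?thesis
      by (simp add: dvd_add_left_iff)
  qed
  show ?thesis
  proof
    show "coprime (c * p + 1 * h) g" "coprime ((1 - c) * p + (-1) * h) g"
      by (rule coprimeI, rule nd; use c in simp)+
  qed (simp add: algebra_simps)
qed

lemma linear_dvd_minus_value:
  fixes p :: "'a::field poly"
  shows "[:- a, 1:] dvd p - [:poly p a:]"
  by (simp add: dvd_iff_poly_eq_0)

lemma two_element_field_cases:
  fixes c :: "'a::{finite,field}"
  assumes "CARD('a) = 2"
  shows "c = 0 \<or> c = 1"
proof -
  have "{0, 1 :: 'a} = UNIV"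
    using assms by (intro card_subset_eq) auto
  thus ?thesis
    by blast
qed

text \<open>
  A field with more than two elements has a constant \<open>c\<close> other than \<open>0\<close> and \<open>1\<close>, and
  \<open>sum_of_two_coprime\<close> applies directly. Over \<open>F\<^sub>2\<close> the replacement is \<open>c = x\<close>, with
  \<open>1 - c = x + 1\<close>. At most one of these two can share a factor with \<open>g\<close>, and it does no harm if it
  divides \<open>p\<close>; subtracting from \<open>p\<close> its value at the corresponding root achieves that, at the
  cost of one more summand, which is \<open>0\<close> or the unit \<open>1\<close>.
\<close>

lemma coprime_polys_generate_additively:
  fixes g p :: "'a::{finite, field_gcd} poly"
  assumes "g \<noteq> 0"
    and card: "CARD('a) \<noteq> 2 \<or> \<not> ([:0, 1:] * [:1, 1:]) dvd g"
    and add: "\<And>a b. a \<in> A \<Longrightarrow> b \<in> A \<Longrightarrow> a + b \<in> A"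
    and unit: "\<And>u. coprime u g \<Longrightarrow> u \<in> A"
  shows "p \<in> A"
proof (cases "CARD('a) = 2")
  case False
  have "\<exists>c :: 'a. c \<noteq> 0 \<and> c \<noteq> 1"
  proof (rule ccontr)
    assume "\<not> ?thesis"
    hence "UNIV = {0, 1 :: 'a}"
      by auto
    hence "CARD('a) = card {0, 1 :: 'a}"
      by (rule arg_cong)
    thus False
      using False by simp
  qed
  then obtain c :: 'a where "c \<noteq> 0" "c \<noteq> 1"
    by blast
  hence "is_unit [:c:]" "is_unit (1 - [:c:])"
    by (simp_all add: one_pCons is_unit_pCons_iff dvd_field_iff)
  hence "\<not> P dvd [:c:] \<and> \<not> P dvd 1 - [:c:]" if "prime P" for P :: "'a poly"
    using that by (meson dvd_trans not_prime_unit)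
  then obtain u v where "coprime u g" "coprime v g" "p = u + v"
    by (rule sum_of_two_coprime[OF assms(1)])
  thus ?thesis
    using add unit by blast
next
  case True
  note two = two_element_field_cases[OF True]
  have neg1: "- 1 = (1 :: 'a)"
    using two[of "- 1"] by simp
  obtain a where a: "poly g a \<noteq> 0"
  proof -
    have False if "poly g 0 = 0" "poly g 1 = 0"
    proof -
      have "coprime [:0, 1 :: 'a:] [:1, 1:]"
        by (rule coprimeI) (use dvd_diff[of _ "[:1, 1 :: 'a:]" "[:0, 1:]"] in \<open>simp add: one_pCons\<close>)
      moreover have "[:- 0, 1:] dvd g" "[:- 1, 1:] dvd g"
        using that by (simp_all only: poly_eq_0_iff_dvd)
      ultimately have "[:0, 1:] * [:1, 1:] dvd g"
        by (intro divides_mult) (simp_all add: neg1)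
      thus False
        using card True by simp
    qed
    thus ?thesis
      using that by blast
  qed
  define b where "b = 1 - a"
  define p' where "p' = p - [:poly p b:]"
  have ndvd: "\<not> P dvd [:- e, 1:]" if P: "prime P" "P dvd g" "\<not> P dvd p'" for P e
  proof
    assume dvd: "P dvd [:- e, 1:]"
    consider "e = a" | "e = b"
      using two[of a] two[of e] by (auto simp: b_def)
    thus False
    proof cases
      case 1
      hence "P dvd g - [:poly g a:]"
        using dvd linear_dvd_minus_value dvd_trans by blast
      hence "P dvd [:poly g a:]"
        using P(2) dvd_diff[of P g "g - [:poly g a:]"] by simp
      moreover have "is_unit [:poly g a:]"
        using a by (simp add: is_unit_pCons_iff)
      ultimately show False
        using P(1) by (meson dvd_trans not_prime_unit)
    next
      case 2
      thus False
        using dvd P(3) linear_dvd_minus_value dvd_trans unfolding p'_def by blast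
    qed
  qed
  have "\<not> P dvd [:0, 1:] \<and> \<not> P dvd 1 - [:0, 1:]" if "prime P" "P dvd g" "\<not> P dvd p'" for P
    using ndvd[OF that, of 0] ndvd[OF that, of 1] by (simp add: one_pCons neg1)
  then obtain u v where uv: "coprime u g" "coprime v g" "p' = u + v"
    by (rule sum_of_two_coprime[OF assms(1)])
  hence p': "p' \<in> A"
    using add unit by blast
  show ?thesis
  proof (cases "poly p b = 0")
    case True
    thus ?thesis
      using p' by (simp add: p'_def)
  next
    case False
    hence "poly p b = 1"
      using two by blast
    hence "p = p' + 1"
      by (simp add: p'_def one_pCons)
    thus ?thesis
      using add[OF p' unit[of 1]] by simp
  qed
qed

section \<open>Bezout for arbitrary sets\<close>

text \<open>
  Euclidean division shows that a nonzero element \<open>m\<close> of minimal size in the ideal divides all of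
  it. In particular \<open>m\<close> divides \<open>Gcd D\<close>, so \<open>Gcd D\<close> is a multiple of \<open>m\<close>.
\<close>

lemma Gcd_in_ideal:
  fixes I D :: "'b::{euclidean_ring, semiring_Gcd} set"
  assumes zero: "0 \<in> I"
    and diff: "\<And>a b. a \<in> I \<Longrightarrow> b \<in> I \<Longrightarrow> a - b \<in> I"
    and mult: "\<And>a r. a \<in> I \<Longrightarrow> a * r \<in> I"
    and "D \<subseteq> I"
  shows "Gcd D \<in> I"
proof (cases "I \<subseteq> {0}")
  case True
  hence "Gcd D = 0"
    using assms(4) by (simp only: Gcd_0_iff)
  thus ?thesis
    using zero by (simp only:)
next
  case False
  define m where "m = arg_min euclidean_size (\<lambda>x. x \<in> I \<and> x \<noteq> 0)"
  obtain x where "x \<in> I \<and> x \<noteq> 0"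
    using False by blast
  hence m: "m \<in> I \<and> m \<noteq> 0" and least: "\<And>y. y \<in> I \<and> y \<noteq> 0 \<Longrightarrow> euclidean_size m \<le> euclidean_size y"
    unfolding m_def by (rule arg_min_nat_lemma[THEN conjunct1],
        metis (mono_tags, lifting) arg_min_nat_le)
  have "m dvd y" if "y \<in> I" for y
  proof -
    have "y mod m \<in> I"
      using diff[OF that mult[of m "y div m"]] m by (simp add: minus_mult_div_eq_mod)
    thus ?thesis
      using least[of "y mod m"] mod_size_less[of m y] m by (fastforce simp: mod_eq_0_iff_dvd)
  qed
  hence "m dvd Gcd D"
    using assms(4) by (auto intro: Gcd_greatest)
  thus ?thesis
    using mult m by (auto elim!: dvdE)
qed

section \<open>Walks in the gcd-graph\<close>

text \<open>
  The notion of connectedness in \<open>Digraph_Component\<close> passes to the symmetric closure, which changes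
  nothing for a symmetric digraph.
\<close>

lemma connected_gcd_graph_iff:
  fixes f :: "'a::{finite, field_gcd} poly"
  assumes "lead_coeff f = 1" and "f \<notin> D"
  shows "Digraph_Component.connected (with_proj (gcd_graph f D)) \<longleftrightarrow>
    (\<forall>u v. (poly_cong f `` {u}) \<rightarrow>\<^sup>*\<^bsub>with_proj (gcd_graph f D)\<^esub> (poly_cong f `` {v}))"
    (is "connected ?G \<longleftrightarrow> _")
proof -
  interpret pair_graph "gcd_graph f D"
    using assms by (rule pair_graph_gcd_graph)
  have verts: "verts ?G = range (\<lambda>u. poly_cong f `` {u})"
    by (auto simp: gcd_graph_def residue_classes_def quotient_def)
  have "symcl (arcs_ends ?G) = arcs_ends ?G"
    using sym_arcs by (auto simp: symcl_def symmetric_def elim: symE)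
  hence "connected ?G \<longleftrightarrow> strongly_connected ?G"
    by (simp only: connected_conv strongly_connected_def reachable_def)
  thus ?thesis
    unfolding strongly_connected_def verts by auto
qed

lemma reachable_imp_Gcd_dvd_diff:
  fixes f :: "'a::{finite, field_gcd} poly"
  assumes "D \<noteq> {}" and "\<And>g. g \<in> D \<Longrightarrow> g dvd f"
    and "(poly_cong f `` {u}) \<rightarrow>\<^sup>*\<^bsub>with_proj (gcd_graph f D)\<^esub> V"
    and "v \<in> V"
  shows "Gcd D dvd u - v"
proof -
  let ?w = "Gcd D"
  have wf: "?w dvd f"
    using assms(1,2) by (meson Gcd_dvd dvd_trans ex_in_conv)
  have cong: "?w dvd s - t" if "s \<in> poly_cong f `` {r}" "t \<in> poly_cong f `` {r}" for r s t
  proof -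
    have "f dvd (r - t) - (r - s)"
      using that by (intro dvd_diff[of f "r - t" "r - s"]) (simp_all add: poly_cong_def)
    hence "f dvd s - t"
      by simp
    with wf show ?thesis
      by (rule dvd_trans)
  qed
  have "\<forall>v\<in>V. ?w dvd u - v"
    using assms(3) unfolding reachable_def
  proof (induction rule: rtrancl_on_induct)
    case base
    show ?case
      using cong[of u u] by (auto simp: poly_cong_def)
  next
    case (step Y Z)
    have "(Y, Z) \<in> parcs (gcd_graph f D)"
      using step.hyps by simp
    then obtain y z where yz: "y \<in> Y" "z \<in> Z" "gcd (y - z) f \<in> D" and Z: "Z \<in> residue_classes f"
      by (auto simp: gcd_graph_def)
    have "?w dvd gcd (y - z) f"
      using yz(3) by (rule Gcd_dvd)
    hence w1: "?w dvd y - z"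
      by simp
    have w2: "?w dvd u - y"
      using step.IH yz(1) by blast
    show ?case
    proof
      fix z' assume "z' \<in> Z"
      with Z yz(2) have "?w dvd z - z'"
        using cong by (metis residue_classes_cases)
      with w1 w2 have "?w dvd (u - y) + (y - z) + (z - z')"
        by (intro dvd_add)
      thus "?w dvd u - z'"
        by simp
    qed
  qed
  thus ?thesis
    using assms(4) by blast
qed

theorem corollary3p4:
  fixes f :: "'a::{finite, field_gcd} poly" and D :: "'a poly set"
  assumes "lead_coeff f = 1"
    and "D \<noteq> {}"
    and "\<And>g. g \<in> D \<Longrightarrow> lead_coeff g = 1 \<and> g dvd f"
    and "f \<notin> D"
    and "CARD('a) \<noteq> 2 \<or> (CARD('a) = 2 \<and> \<not> ([:0, 1:] * [:1, 1:]) dvd f)"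
  shows "Digraph_Component.connected (with_proj (gcd_graph f D)) \<longleftrightarrow> Gcd D = 1"
proof -
  let ?G = "with_proj (gcd_graph f D)"
  let ?c = "\<lambda>u. poly_cong f `` {u}"
  interpret pair_graph "gcd_graph f D"
    using assms(1,4) by (rule pair_graph_gcd_graph)
  have conn: "connected ?G \<longleftrightarrow> (\<forall>u v. (?c u) \<rightarrow>\<^sup>*\<^bsub>?G\<^esub> (?c v))"
    using assms(1,4) by (rule connected_gcd_graph_iff)
  have f0: "f \<noteq> 0"
    using assms(1) by auto
  show ?thesis
  proof
    assume "connected ?G"
    hence "(?c 1) \<rightarrow>\<^sup>*\<^bsub>?G\<^esub> (?c 0)"
      using conn by blast
    hence "Gcd D dvd 1 - 0"
      using assms(2,3) by (rule_tac reachable_imp_Gcd_dvd_diff) (auto simp: poly_cong_def)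
    thus "Gcd D = 1"
      using normalize_Gcd[of D] by (metis diff_zero is_unit_normalize)
  next
    assume Gcd: "Gcd D = 1"
    define A where "A = {a. \<forall>u. (?c u) \<rightarrow>\<^sup>*\<^bsub>?G\<^esub> (?c (u + a))}"
    have "?c u \<in> verts ?G" for u
      by (simp add: gcd_graph_def residue_classes_def quotientI)
    hence A_zero: "0 \<in> A"
      by (simp add: A_def)
    have A_add: "a + b \<in> A" if "a \<in> A" "b \<in> A" for a b
      unfolding A_def
    proof (intro CollectI allI)
      fix u
      have "(?c u) \<rightarrow>\<^sup>*\<^bsub>?G\<^esub> (?c (u + a))" "(?c (u + a)) \<rightarrow>\<^sup>*\<^bsub>?G\<^esub> (?c (u + a + b))"
        using that by (simp_all only: A_def mem_Collect_eq)
      thus "(?c u) \<rightarrow>\<^sup>*\<^bsub>?G\<^esub> (?c (u + (a + b)))"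
        unfolding add.assoc[symmetric] by (rule reachable_trans)
    qed
    have A_gcd: "a \<in> A" if "gcd a f \<in> D" for a
    proof -
      have "gcd (u - (u + a)) f \<in> D" for u
        using that by simp
      hence "(?c u, ?c (u + a)) \<in> parcs (gcd_graph f D)" for u
        by (simp only: gcd_graph_adjacent_iff)
      thus ?thesis
        by (auto simp: A_def intro!: reachable_adjI)
    qed
    have A_mult: "d * p \<in> A" if d: "d \<in> D" for d p
    proof -
      obtain g where g: "f = d * g"
        using assms(3)[OF d] by (auto elim: dvdE)
      have "p \<in> {p. d * p \<in> A}"
      proof (rule coprime_polys_generate_additively)
        show "g \<noteq> 0"
          using f0 g by auto
        show "CARD('a) \<noteq> 2 \<or> \<not> ([:0, 1:] * [:1, 1:]) dvd g"
          using assms(5) g by auto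
        show "a + b \<in> {p. d * p \<in> A}" if "a \<in> {p. d * p \<in> A}" "b \<in> {p. d * p \<in> A}" for a b
          using that A_add by (simp add: distrib_left)
        show "u \<in> {p. d * p \<in> A}" if "coprime u g" for u
        proof -
          have "gcd (d * u) f = normalize (d * gcd u g)"
            unfolding g by (rule gcd_mult_left)
          also have "\<dots> = d"
            using that assms(3)[OF d] by (simp add: normalize_poly_eq_map_poly)
          finally show ?thesis
            using A_gcd d by simp
        qed
      qed
      thus ?thesis
        by simp
    qed
    \<comment> \<open>The largest ideal contained in \<open>A\<close>.\<close>
    define I where "I = {a. \<forall>r. a * r \<in> A}"
    have "Gcd D \<in> I"
    proof (rule Gcd_in_ideal)
      show "a - b \<in> I" if "a \<in> I" "b \<in> I" for a b
      proof -
        have "a * r + b * (- r) \<in> A" for r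
          using that A_add unfolding I_def by blast
        thus ?thesis
          by (simp add: I_def algebra_simps)
      qed
    qed (use A_zero A_mult in \<open>auto simp: I_def mult.assoc\<close>)
    hence A: "a \<in> A" for a
      unfolding Gcd I_def by simp
    have "(?c u) \<rightarrow>\<^sup>*\<^bsub>?G\<^esub> (?c (u + (v - u)))" for u v
      using A by (simp only: A_def mem_Collect_eq)
    thus "connected ?G"
      by (simp add: conn)
  qed
qed

end
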